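(* (i) For a graph $G$ of order $n\ge 1$, $\Gamma(G)\le \frac{n+\omega(G)}{2}$. (ii) Let $k$ and $n$ be any two integers such that $k+n$ is even and $k\le n$. Then there exists a graph $G_{k,n}$ on $n$ vertices such that $\omega(G_{k,n})=k$ and $\Gamma(G_{k,n})=\frac{n+k}{2}$. (iii) In particular, if $G$ is a connected triangle-free graph of order $n\ge 2$, then $\Gamma(G)=\frac{n+2}{2}$ if and only if $G\cong B_{\frac{n+2}{2}}$.
   Context: All graphs are finite and simple. The order of $G$ is its number of vertices. $\omega(G)$ is the clique number (maximum size of a set of pairwise adjacent vertices). A Grundy $k$-coloring of $G$ is a partition of $V(G)$ into $k$ nonempty independent sets $V_1,\dots,V_k$ such that for every $i$, every vertex $v\in V_i$ has at least one neighbor in each $V_j$ with $j<i$. The Grundy number $\Gamma(G)$ is the largest integer $k$ for which $G$ has a Grundy $k$-coloring. For an integer $k\ge 2$, $B_k$ is the graph (on $2k-2$ vertices) obtained from the complete bipartite graph $K_{k-1,k-1}$ by deleting the edges of a matching of cardinality $k-2$.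
   Formalization: In (ii), k and n are taken to be non-negative integers with k ≥ 2 or k = n, since the printed claim fails otherwise: for k = 1, n = 3 the graph is edgeless and Γ = 1, not 2; and no nonempty graph has clique number k ≤ 0. *)

theory Defs
  imports Complex_Main "HOL-Library.Disjoint_Sets" "Graph_Theory.Graph_Theory"
begin

text \<open>
  A finite simple graph is a \<^locale>\<open>pair_graph\<close>: a finite vertex set \<^term>\<open>pverts G\<close> with a
  symmetric, loop-free set \<^term>\<open>parcs G\<close> of pairs of vertices. Each undirected edge is thus
  represented by its two orientations.
\<close>

definition clique :: "'a pair_pre_digraph \<Rightarrow> 'a set \<Rightarrow> bool" where
  "clique G S \<longleftrightarrow> S \<subseteq> pverts G \<and> (\<forall>u\<in>S. \<forall>v\<in>S. u \<noteq> v \<longrightarrow> (u, v) \<in> parcs G)"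

definition clique_number :: "'a pair_pre_digraph \<Rightarrow> nat" where
  "clique_number G = Max {card S | S. clique G S}"

definition independent_set :: "'a pair_pre_digraph \<Rightarrow> 'a set \<Rightarrow> bool" where
  "independent_set G S \<longleftrightarrow> S \<subseteq> pverts G \<and> (\<forall>u\<in>S. \<forall>v\<in>S. (u, v) \<notin> parcs G)"

definition grundy_coloring :: "'a pair_pre_digraph \<Rightarrow> nat \<Rightarrow> (nat \<Rightarrow> 'a set) \<Rightarrow> bool" where
  "grundy_coloring G k V \<longleftrightarrow>
     (\<Union>i\<in>{1..k}. V i) = pverts G \<and>
     disjoint_family_on V {1..k} \<and>
     (\<forall>i\<in>{1..k}. V i \<noteq> {} \<and> independent_set G (V i)) \<and>
     (\<forall>i\<in>{1..k}. \<forall>v\<in>V i. \<forall>j\<in>{1..<i}. \<exists>u\<in>V j. (v, u) \<in> parcs G)"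

text \<open>
  For a finite simple graph the set below is finite (nonempty disjoint classes give
  \<open>k \<le> card (pverts G)\<close>) and nonempty (first-fit coloring), so the maximum is attained.
\<close>

definition grundy_number :: "'a pair_pre_digraph \<Rightarrow> nat" where
  "grundy_number G = Max {k. \<exists>V. grundy_coloring G k V}"

definition triangle_free :: "'a pair_pre_digraph \<Rightarrow> bool" where
  "triangle_free G \<longleftrightarrow>
     \<not> (\<exists>u v w. (u, v) \<in> parcs G \<and> (v, w) \<in> parcs G \<and> (w, u) \<in> parcs G)"

text \<open>
  The graph \<open>B\<^sub>k\<close> for \<open>k \<ge> 2\<close>. The Boolean component tells the two sides of \<open>K\<^bsub>k-1,k-1\<^esub>\<close> apart;
  the deleted matching joins the vertices with equal index \<open>i < k - 2\<close>.
\<close>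

definition B_graph :: "nat \<Rightarrow> (bool \<times> nat) pair_pre_digraph" where
  "B_graph k =
     \<lparr> pverts = UNIV \<times> {..<k - 1},
       parcs = {((s, i), (t, j)) | s t i j. s \<noteq> t \<and> i < k - 1 \<and> j < k - 1}
             - {((s, i), (t, i)) | s t i. s \<noteq> t \<and> i < k - 2} \<rparr>"

end

theory Submission
  imports Defs
begin

text \<open>
  Everything rests on one observation about a Grundy coloring with \<open>k\<close> classes: the vertices that
  are alone in their classes are pairwise adjacent, because of any two of them the one in the
  higher class needs a neighbour in the lower class, and there is only one candidate. So at most
  \<open>\<omega>(G)\<close> classes are singletons, all others have at least two vertices, and counting vertices
  gives \<open>n \<ge> 2k - \<omega>(G)\<close> (lemma \<open>grundy_coloring_bound\<close>).

  The bound is attained for \<open>n = k + 2m\<close> by arranging \<open>m\<close> nonadjacent pairs below \<open>k\<close> mutually adjacent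
  singletons. To keep the clique number at \<open>k\<close>, the pairs and two of the singletons carry a
  bipartite graph, and the remaining \<open>k - 2\<close> singletons are joined to everything. A clique then
  contains at most two vertices of the bipartite part.

  If a triangle-free graph attains the bound, the count is tight: with \<open>k\<close> classes, exactly two
  are singletons \<open>{x}\<close>, \<open>{y}\<close> and all others are pairs. A class above both, or strictly between
  them, would produce a triangle containing \<open>x\<close> and \<open>y\<close>, so these are the two highest classes
  (lemma \<open>singleton_classes_on_top\<close>). Each pair consists of one neighbour \<open>a\<^sub>j\<close> of \<open>x\<close> and one
  neighbour \<open>b\<^sub>j\<close> of \<open>y\<close>. Neighbours of the same vertex are nonadjacent, so a vertex can meet the
  Grundy condition towards a lower pair only through the member of the opposite kind. Hence
  \<open>a\<^sub>i\<close> and \<open>b\<^sub>j\<close> are adjacent exactly for \<open>i \<noteq> j\<close>, and the graph is \<open>B\<^sub>k\<close> with sides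
  \<open>{a\<^sub>j} \<union> {y}\<close> and \<open>{b\<^sub>j} \<union> {x}\<close>. Conversely, the same classes form a Grundy coloring of \<open>B\<^sub>k\<close>.
\<close>

section \<open>Cliques and triangles\<close>

lemma pair_graph_arc_commute:
  assumes "pair_graph G"
  shows "(u, v) \<in> parcs G \<longleftrightarrow> (v, u) \<in> parcs G"
proof -
  interpret pair_graph G by fact
  show ?thesis
    by (rule iffI; rule arcs_symmetric)
qed

lemma pair_graph_loopless:
  assumes "pair_graph G"
  shows "(v, v) \<notin> parcs G"
proof
  interpret pair_graph G by fact
  assume "(v, v) \<in> parcs G"
  then show False
    using pair_no_loops[of "(v, v)"] by simp
qed

lemma finite_clique_cards:
  assumes "finite (pverts G)"
  shows "finite {card S |S. clique G S}"
proof -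
  have "{card S |S. clique G S} \<subseteq> card ` Pow (pverts G)"
    by (auto simp: clique_def)
  then show ?thesis
    using assms by (meson finite_Pow_iff finite_imageI finite_subset)
qed

lemma card_le_clique_number:
  assumes "finite (pverts G)" "clique G S"
  shows "card S \<le> clique_number G"
  unfolding clique_number_def using assms finite_clique_cards by (intro Max_ge) auto

lemma clique_number_le:
  assumes "finite (pverts G)" "\<And>S. clique G S \<Longrightarrow> card S \<le> b"
  shows "clique_number G \<le> b"
proof -
  have "clique G {}"
    by (simp add: clique_def)
  then show ?thesis
    unfolding clique_number_def using assms finite_clique_cards
    by (subst Max_le_iff) auto
qed

lemma triangle_free_neighbours:
  assumes "pair_graph G" "triangle_free G" "(u, v) \<in> parcs G" "(u, w) \<in> parcs G"
  shows "(v, w) \<notin> parcs G"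
proof
  assume "(v, w) \<in> parcs G"
  moreover have "(w, u) \<in> parcs G"
    using assms(4) pair_graph_arc_commute[OF assms(1)] by simp
  ultimately show False
    using assms(2,3) unfolding triangle_free_def by blast
qed

lemma clique_number_triangle_free:
  assumes "finite (pverts G)" "triangle_free G"
  shows "clique_number G \<le> 2"
proof (rule clique_number_le[OF assms(1)], rule ccontr)
  fix S assume S: "clique G S" and "\<not> card S \<le> 2"
  then obtain T where "T \<subseteq> S" "card T = 3"
    by (metis not_less_eq_eq numeral_2_eq_2 numeral_3_eq_3 obtain_subset_with_card_n)
  then obtain u v w where "{u, v, w} \<subseteq> S" "u \<noteq> v" "v \<noteq> w" "u \<noteq> w"
    by (auto simp: card_3_iff)
  then have "(u, v) \<in> parcs G" "(v, w) \<in> parcs G" "(w, u) \<in> parcs G"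
    using S by (auto simp: clique_def)
  then show False
    using assms(2) unfolding triangle_free_def by blast
qed

section \<open>Greedy labellings\<close>

text \<open>
  A Grundy coloring given by a color function with colors counted from 0. In this form colorings
  can be extended by one vertex and pulled back along isomorphisms.
\<close>

definition greedy_labelling :: "'a pair_pre_digraph \<Rightarrow> ('a \<Rightarrow> nat) \<Rightarrow> nat \<Rightarrow> bool" where
  "greedy_labelling G c k \<longleftrightarrow>
     c ` pverts G = {..<k} \<and>
     (\<forall>u v. (u, v) \<in> parcs G \<longrightarrow> c u \<noteq> c v) \<and>
     (\<forall>v\<in>pverts G. \<forall>j<c v. \<exists>u\<in>pverts G. (v, u) \<in> parcs G \<and> c u = j)"

lemma grundy_coloring_greedy_labelling:
  assumes "greedy_labelling G c k"
  shows "grundy_coloring G k (\<lambda>i. {v \<in> pverts G. Suc (c v) = i})"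
proof -
  have img: "c ` pverts G = {..<k}"
    and proper: "\<And>u v. (u, v) \<in> parcs G \<Longrightarrow> c u \<noteq> c v"
    and greedy: "\<And>v j. v \<in> pverts G \<Longrightarrow> j < c v \<Longrightarrow> \<exists>u\<in>pverts G. (v, u) \<in> parcs G \<and> c u = j"
    using assms by (auto simp: greedy_labelling_def)
  have lt: "c v < k" if "v \<in> pverts G" for v
    using img that by auto
  have ne: "{v \<in> pverts G. Suc (c v) = i} \<noteq> {}" if "i \<in> {1..k}" for i
  proof -
    from that have "i - 1 \<in> c ` pverts G"
      unfolding img by auto
    then show ?thesis
      using that by auto
  qed
  have nb: "\<exists>u\<in>{v \<in> pverts G. Suc (c v) = j}. (v, u) \<in> parcs G"
    if "v \<in> pverts G" "1 \<le> j" "j < Suc (c v)" for v j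
  proof -
    obtain u where "u \<in> pverts G" "(v, u) \<in> parcs G" "c u = j - 1"
      using greedy[of v "j - 1"] \<open>v \<in> pverts G\<close> \<open>1 \<le> j\<close> \<open>j < Suc (c v)\<close> by fastforce
    then show ?thesis
      using that by (intro bexI[of _ u]) auto
  qed
  show ?thesis
    unfolding grundy_coloring_def
  proof (intro conjI)
    show "(\<Union>i\<in>{1..k}. {v \<in> pverts G. Suc (c v) = i}) = pverts G"
      using lt by (fastforce simp: Suc_le_eq)
    show "disjoint_family_on (\<lambda>i. {v \<in> pverts G. Suc (c v) = i}) {1..k}"
      by (auto simp: disjoint_family_on_def)
    show "\<forall>i\<in>{1..k}. {v \<in> pverts G. Suc (c v) = i} \<noteq> {} \<and>
        independent_set G {v \<in> pverts G. Suc (c v) = i}"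
    proof (intro ballI conjI)
      fix i assume "i \<in> {1..k}"
      then show "{v \<in> pverts G. Suc (c v) = i} \<noteq> {}"
        by (rule ne)
      show "independent_set G {v \<in> pverts G. Suc (c v) = i}"
        unfolding independent_set_def using proper by fastforce
    qed
    show "\<forall>i\<in>{1..k}. \<forall>v\<in>{v \<in> pverts G. Suc (c v) = i}. \<forall>j\<in>{1..<i}.
        \<exists>u\<in>{v \<in> pverts G. Suc (c v) = j}. (v, u) \<in> parcs G"
      using nb by (auto simp del: mem_Collect_eq)
  qed
qed

text \<open>
  First-fit coloring: the new vertex gets the least color absent from its neighbours. Colors of
  earlier vertices never change, so they keep their witnesses in the lower classes. This guarantees
  that the maximum defining the Grundy number ranges over a nonempty set.
\<close>

lemma first_fit_greedy:
  assumes "finite U" "sym E" "irrefl E"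
  shows "\<exists>(c :: 'a \<Rightarrow> nat) k. c ` U = {..<k} \<and>
      (\<forall>u\<in>U. \<forall>v\<in>U. (u, v) \<in> E \<longrightarrow> c u \<noteq> c v) \<and>
      (\<forall>v\<in>U. \<forall>j<c v. \<exists>u\<in>U. (v, u) \<in> E \<and> c u = j)"
  using assms(1)
proof (induction U rule: finite_induct)
  case empty
  show ?case
    by (rule exI[of _ "\<lambda>_. 0"], rule exI[of _ 0]) simp
next
  case (insert x U)
  then obtain c :: "'a \<Rightarrow> nat" and k where img: "c ` U = {..<k}"
    and proper: "\<And>u v. u \<in> U \<Longrightarrow> v \<in> U \<Longrightarrow> (u, v) \<in> E \<Longrightarrow> c u \<noteq> c v"
    and greedy: "\<And>v j. v \<in> U \<Longrightarrow> j < c v \<Longrightarrow> \<exists>u\<in>U. (v, u) \<in> E \<and> c u = j"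
    by metis
  \<comment> \<open>The least free color \<open>d\<close> of \<open>x\<close> is at most \<open>k\<close>, so the set of used colors stays an initial segment.\<close>
  define free where "free j \<longleftrightarrow> (\<forall>u\<in>U. (x, u) \<in> E \<longrightarrow> c u \<noteq> j)" for j
  define d where "d = (LEAST j. free j)"
  have "free k"
    using img by (auto simp: free_def)
  then have d_free: "free d" and d_le: "d \<le> k"
    unfolding d_def by (auto intro: LeastI Least_le)
  have below_d: "\<exists>u\<in>U. (x, u) \<in> E \<and> c u = j" if "j < d" for j
    using not_less_Least[of j free] that unfolding d_def[symmetric] by (auto simp: free_def)
  define c' where "c' = c(x := d)"
  have old: "c' u = c u" if "u \<in> U" for u
    using that insert.hyps by (auto simp: c'_def)
  have new: "c' x = d"
    by (simp add: c'_def)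
  have "c' ` insert x U = insert d {..<k}"
    using img old new by (metis image_cong image_insert)
  also have "\<dots> = {..<max k (Suc d)}"
    using d_le by (auto simp: max_def)
  finally have img': "c' ` insert x U = {..<max k (Suc d)}" .
  have proper': "c' u \<noteq> c' v" if "u \<in> insert x U" "v \<in> insert x U" "(u, v) \<in> E" for u v
  proof -
    have "u \<noteq> v"
      using that(3) assms(3) by (auto simp: irrefl_def)
    moreover have "(v, u) \<in> E"
      using that(3) assms(2) by (auto dest: symD)
    ultimately show ?thesis
      using that d_free proper old new by (auto simp: free_def)
  qed
  have greedy': "\<exists>u\<in>insert x U. (v, u) \<in> E \<and> c' u = j" if "v \<in> insert x U" "j < c' v" for v j
  proof (cases "v = x")
    case True
    then show ?thesis
      using below_d[of j] that old new by auto
  next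
    case False
    then show ?thesis
      using greedy[of v j] that old by auto
  qed
  show ?case
    using img' proper' greedy' by blast
qed

section \<open>The upper bound\<close>

lemma grundy_classes_cover:
  assumes "grundy_coloring G k V"
  shows "(\<Union>i\<in>{1..k}. V i) = pverts G"
  using assms unfolding grundy_coloring_def by (elim conjE)

lemma grundy_class_subset:
  assumes "grundy_coloring G k V" "i \<in> {1..k}"
  shows "V i \<subseteq> pverts G"
  using UN_upper[OF assms(2), of V] grundy_classes_cover[OF assms(1)] by simp

lemma grundy_class_nonempty:
  assumes "grundy_coloring G k V" "i \<in> {1..k}"
  shows "V i \<noteq> {}"
  using assms by (simp add: grundy_coloring_def)

lemma grundy_class_independent:
  assumes "grundy_coloring G k V" "i \<in> {1..k}" "u \<in> V i" "v \<in> V i"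
  shows "(u, v) \<notin> parcs G"
proof -
  have "independent_set G (V i)"
    using assms(1,2) by (simp add: grundy_coloring_def)
  then show ?thesis
    using assms(3,4) by (simp add: independent_set_def)
qed

lemma grundy_class_neighbour:
  assumes "grundy_coloring G k V" "i \<in> {1..k}" "v \<in> V i" "1 \<le> j" "j < i"
  shows "\<exists>u\<in>V j. (v, u) \<in> parcs G"
proof -
  have "\<forall>i\<in>{1..k}. \<forall>v\<in>V i. \<forall>j\<in>{1..<i}. \<exists>u\<in>V j. (v, u) \<in> parcs G"
    using assms(1) unfolding grundy_coloring_def by (elim conjE)
  moreover have "j \<in> {1..<i}"
    using assms(4,5) by simp
  ultimately show ?thesis
    using assms(2,3) by blast
qed

lemma sum_card_grundy_classes:
  assumes "finite (pverts G)" "grundy_coloring G k V"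
  shows "(\<Sum>i\<in>{1..k}. card (V i)) = card (pverts G)"
proof -
  have "card (\<Union>i\<in>{1..k}. V i) = (\<Sum>i\<in>{1..k}. card (V i))"
    using assms grundy_class_subset[OF assms(2)] by (intro card_UN_disjoint')
      (auto simp: grundy_coloring_def dest: finite_subset)
  then show ?thesis
    using assms(2) by (simp add: grundy_coloring_def)
qed

text \<open>
  The vertices of the singleton classes form a clique: the Grundy condition leaves the vertex of
  the higher class no other neighbour in the lower class.
\<close>

lemma card_singleton_classes_le_clique_number:
  assumes "pair_graph G" "grundy_coloring G k V"
  shows "card {i \<in> {1..k}. card (V i) = 1} \<le> clique_number G"
proof -
  interpret pair_graph G by fact
  let ?I = "{i \<in> {1..k}. card (V i) = 1}"
  define r where "r i = the_elem (V i)" for i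
  have r: "V i = {r i}" if i: "i \<in> ?I" for i
  proof -
    have "card (V i) = 1"
      using i by simp
    then obtain x where "V i = {x}"
      by (rule card_1_singletonE)
    then show ?thesis
      by (simp add: r_def)
  qed
  have adj: "(r i, r j) \<in> parcs G" if ij: "i \<in> ?I" "j \<in> ?I" "j < i" for i j
    using grundy_class_neighbour[OF assms(2), of i "r i" j] r[OF ij(1)] r[OF ij(2)] ij by simp
  have adj': "(r i, r j) \<in> parcs G" if "i \<in> ?I" "j \<in> ?I" "i \<noteq> j" for i j
  proof (cases "j < i")
    case True
    then show ?thesis
      using adj that by blast
  next
    case False
    then have "(r j, r i) \<in> parcs G"
      using adj[of j i] that by linarith
    then show ?thesis
      by (rule arcs_symmetric)
  qed
  have "inj_on r ?I"
  proof (rule inj_onI, rule ccontr)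
    fix i j assume "i \<in> ?I" "j \<in> ?I" "r i = r j" "i \<noteq> j"
    then show False
      using adj'[of i j] pair_graph_loopless[OF assms(1), of "r j"] by simp
  qed
  then have "card (r ` ?I) = card ?I"
    by (rule card_image)
  moreover have "clique G (r ` ?I)"
  proof -
    have "r i \<in> pverts G" if "i \<in> ?I" for i
      using grundy_class_subset[OF assms(2), of i] r[OF that] that by simp
    then show ?thesis
      using adj' unfolding clique_def by blast
  qed
  ultimately show ?thesis
    using card_le_clique_number[OF pair_finite_verts] by fastforce
qed

text \<open>
  The lower bound is 1 for singleton classes and 2 otherwise. Written as one expression it can be
  summed over all classes, and equality of the sums forces equality in each class.
\<close>

lemma grundy_class_card_ge:
  assumes "finite (pverts G)" "grundy_coloring G k V" "i \<in> {1..k}"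
  shows "2 - of_bool (card (V i) = 1) \<le> card (V i)"
proof -
  have "V i \<noteq> {}" "finite (V i)"
    using assms grundy_class_subset[OF assms(2,3)]
    by (auto simp: grundy_coloring_def intro: finite_subset)
  then have "card (V i) \<noteq> 0"
    by simp
  then show ?thesis
    by (cases "card (V i) = 1") auto
qed

lemma sum_two_minus_of_bool:
  assumes "finite A"
  shows "(\<Sum>i\<in>A. 2 - of_bool (P i) :: nat) + card {i \<in> A. P i} = 2 * card A"
proof -
  have "(\<Sum>i\<in>A. 2 - of_bool (P i) :: nat) + (\<Sum>i\<in>A. of_bool (P i)) = (\<Sum>i\<in>A. 2)"
    unfolding sum.distrib[symmetric] by (intro sum.cong) auto
  then show ?thesis
    using assms by (simp add: Int_def)
qed

lemma grundy_coloring_bound: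
  assumes "pair_graph G" "grundy_coloring G k V"
  shows "2 * k \<le> card (pverts G) + clique_number G"
proof -
  interpret pair_graph G by fact
  have "(\<Sum>i\<in>{1..k}. 2 - of_bool (card (V i) = 1)) \<le> (\<Sum>i\<in>{1..k}. card (V i))"
    by (intro sum_mono grundy_class_card_ge[OF pair_finite_verts assms(2)])
  then show ?thesis
    using sum_two_minus_of_bool[of "{1..k}" "\<lambda>i. card (V i) = 1"]
      card_singleton_classes_le_clique_number[OF assms]
      sum_card_grundy_classes[OF pair_finite_verts assms(2)]
    by simp
qed

lemma finite_grundy_sizes:
  assumes "pair_graph G"
  shows "finite {k. \<exists>V. grundy_coloring G k V}"
proof (rule finite_subset)
  show "{k. \<exists>V. grundy_coloring G k V} \<subseteq> {..card (pverts G) + clique_number G}"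
    using grundy_coloring_bound[OF assms] by fastforce
qed simp

lemma le_grundy_number:
  assumes "pair_graph G" "grundy_coloring G k V"
  shows "k \<le> grundy_number G"
  unfolding grundy_number_def using assms finite_grundy_sizes by (intro Max_ge) auto

lemma grundy_number_attained:
  assumes "pair_graph G"
  obtains V where "grundy_coloring G (grundy_number G) V"
proof -
  interpret pair_graph G by fact
  have "sym (parcs G)"
    by (rule symI) (rule arcs_symmetric)
  moreover have "irrefl (parcs G)"
    using pair_graph_loopless[OF assms] by (simp add: irrefl_def)
  ultimately obtain c :: "'a \<Rightarrow> nat" and k where c: "c ` pverts G = {..<k}"
    "\<forall>u\<in>pverts G. \<forall>v\<in>pverts G. (u, v) \<in> parcs G \<longrightarrow> c u \<noteq> c v"
    "\<forall>v\<in>pverts G. \<forall>j<c v. \<exists>u\<in>pverts G. (v, u) \<in> parcs G \<and> c u = j"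
    using first_fit_greedy[OF pair_finite_verts, of "parcs G"] by blast
  then have "greedy_labelling G c k"
    unfolding greedy_labelling_def using wellformed' by blast
  then have "{k. \<exists>V. grundy_coloring G k V} \<noteq> {}"
    using grundy_coloring_greedy_labelling by blast
  then have "grundy_number G \<in> {k. \<exists>V. grundy_coloring G k V}"
    unfolding grundy_number_def using finite_grundy_sizes[OF assms] by (intro Max_in)
  then show ?thesis
    using that by blast
qed

theorem grundy_number_upper_bound:
  assumes "pair_graph G"
  shows "2 * grundy_number G \<le> card (pverts G) + clique_number G"
  using grundy_number_attained[OF assms] grundy_coloring_bound[OF assms] by metis

section \<open>Graphs attaining the bound\<close>

text \<open>
  The vertices \<open>2i, 2i + 1\<close> for \<open>i < m\<close> are the nonadjacent pairs. All vertices below \<open>2m + 2\<close>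
  form a bipartite graph with parity as its two sides, in which \<open>2m\<close> and \<open>2m + 1\<close> are adjacent to the
  whole opposite side. Vertices from \<open>2m + 2\<close> on are adjacent to all others. For \<open>m = 0\<close> this is the
  complete graph on \<open>k\<close> vertices, also for \<open>k < 2\<close>.
\<close>

definition extremal_graph :: "nat \<Rightarrow> nat \<Rightarrow> nat pair_pre_digraph" where
  "extremal_graph k m =
     \<lparr> pverts = {..<2 * m + k},
       parcs = {(u, v). u < 2 * m + k \<and> v < 2 * m + k \<and> u \<noteq> v \<and>
         \<not> (u < 2 * m + 2 \<and> v < 2 * m + 2 \<and> u mod 2 = v mod 2) \<and>
         \<not> (u < 2 * m \<and> v < 2 * m \<and> u div 2 = v div 2)} \<rparr>"

lemma pair_graph_extremal: "pair_graph (extremal_graph k m)"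
proof
  let ?G = "extremal_graph k m"
  show "finite (pverts ?G)"
    by (simp add: extremal_graph_def)
  have "parcs ?G \<subseteq> {..<2 * m + k} \<times> {..<2 * m + k}"
    by (auto simp: extremal_graph_def)
  then show "finite (parcs ?G)"
    by (rule finite_subset) simp
  show "symmetric (with_proj ?G)"
    by (auto simp: symmetric_def extremal_graph_def intro!: symI)
qed (auto simp: extremal_graph_def)

text \<open>
  For the upper bound, a clique is mapped injectively to \<open>{..<k}\<close>: its vertices in the bipartite part go
  to their parity, the others \<open>v\<close> go to \<open>v - 2m \<ge> 2\<close>. The vertices from \<open>2m\<close> on form a clique of
  size \<open>k\<close>.
\<close>

lemma clique_number_extremal:
  assumes "2 \<le> k \<or> m = 0"
  shows "clique_number (extremal_graph k m) = k"
proof (rule antisym)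
  let ?G = "extremal_graph k m"
  interpret pair_graph ?G by (rule pair_graph_extremal)
  show "clique_number ?G \<le> k"
  proof (rule clique_number_le[OF pair_finite_verts])
    fix S assume S: "clique ?G S"
    then have sub: "S \<subseteq> {..<2 * m + k}"
      by (simp add: clique_def extremal_graph_def)
    show "card S \<le> k"
    proof (cases "2 \<le> k")
      case True
      let ?g = "\<lambda>v. if v < 2 * m + 2 then v mod 2 else v - 2 * m"
      have "inj_on ?g S"
      proof (rule inj_onI, rule ccontr)
        fix u v assume uv: "u \<in> S" "v \<in> S" "?g u = ?g v" "u \<noteq> v"
        then have "(u, v) \<in> parcs ?G"
          using S by (auto simp: clique_def)
        moreover have "u < 2 * m + 2 \<longleftrightarrow> v < 2 * m + 2"
        proof -
          have "?g w < 2 \<longleftrightarrow> w < 2 * m + 2" for w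
            by auto
          then have "?g u < 2 \<longleftrightarrow> u < 2 * m + 2" "?g v < 2 \<longleftrightarrow> v < 2 * m + 2"
            by blast+
          then show ?thesis
            unfolding uv(3) by (rule trans[OF sym])
        qed
        ultimately show False
          using uv by (cases "u < 2 * m + 2") (simp_all add: extremal_graph_def)
      qed
      moreover have "?g ` S \<subseteq> {..<k}"
      proof (rule image_subsetI)
        fix v assume "v \<in> S"
        then have "v < 2 * m + k"
          using sub by auto
        moreover have "v mod 2 < 2"
          by simp
        ultimately show "?g v \<in> {..<k}"
          using True by (auto simp del: mod_less_divisor)
      qed
      ultimately show ?thesis
        by (metis card_inj_on_le card_lessThan finite_lessThan)
    next
      case False
      then show ?thesis
        using assms sub card_mono[OF finite_lessThan sub] by simp
    qed
  qed
  have "clique ?G {2 * m..<2 * m + k}"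
    unfolding clique_def extremal_graph_def by (auto simp: mod2_eq_if) presburger+
  then show "k \<le> clique_number ?G"
    using card_le_clique_number[OF pair_finite_verts] by fastforce
qed

lemma greedy_labelling_extremal:
  assumes "2 \<le> k \<or> m = 0"
  shows "greedy_labelling (extremal_graph k m) (\<lambda>v. if v < 2 * m then v div 2 else v - m) (m + k)"
    (is "greedy_labelling ?G ?c _")
  unfolding greedy_labelling_def
proof (intro conjI ballI allI impI)
  show "?c ` pverts ?G = {..<m + k}"
  proof
    show "?c ` pverts ?G \<subseteq> {..<m + k}"
      by (auto simp: extremal_graph_def)
    show "{..<m + k} \<subseteq> ?c ` pverts ?G"
    proof
      fix j assume "j \<in> {..<m + k}"
      then show "j \<in> ?c ` pverts ?G"
        by (intro image_eqI[of _ _ "if j < m then 2 * j else j + m"])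
          (auto simp: extremal_graph_def)
    qed
  qed
next
  fix u v assume "(u, v) \<in> parcs ?G"
  then show "?c u \<noteq> ?c v"
    by (auto simp: extremal_graph_def)
next
  fix v j assume v: "v \<in> pverts ?G" and j: "j < ?c v"
  \<comment> \<open>Inside the bipartite part the witness in pair \<open>j\<close> is the member of parity opposite to \<open>v\<close>.\<close>
  let ?u = "if j < m then (if v < 2 * m + 2 then 2 * j + (1 - v mod 2) else 2 * j) else j + m"
  have "(v, ?u) \<in> parcs ?G" "?u \<in> pverts ?G" "?c ?u = j"
    using v j assms by (auto simp: extremal_graph_def mod2_eq_if split: if_splits) presburger+
  then show "\<exists>u\<in>pverts ?G. (v, u) \<in> parcs ?G \<and> ?c u = j"
    by blast
qed

lemma grundy_number_extremal:
  assumes "2 \<le> k \<or> m = 0"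
  shows "grundy_number (extremal_graph k m) = m + k"
proof (rule antisym)
  show "grundy_number (extremal_graph k m) \<le> m + k"
    using grundy_number_upper_bound[OF pair_graph_extremal[of k m]] clique_number_extremal[OF assms]
    by (simp add: extremal_graph_def)
  show "m + k \<le> grundy_number (extremal_graph k m)"
    using le_grundy_number pair_graph_extremal
      grundy_coloring_greedy_labelling[OF greedy_labelling_extremal[OF assms]] by blast
qed

section \<open>Triangle-free graphs attaining the bound\<close>

text \<open>
  Isomorphisms of general digraphs also carry an arc map together with new head and tail functions.
  For graphs whose arcs are pairs these are determined by the vertex map.
\<close>

lemma digraph_iso_with_proj_iff:
  assumes "pair_wf_digraph G"
  shows "digraph_iso (with_proj G) (with_proj H) \<longleftrightarrow>
    (\<exists>f. bij_betw f (pverts G) (pverts H) \<and> parcs H = map_prod f f ` parcs G)"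
proof
  assume "digraph_iso (with_proj G) (with_proj H)"
  then obtain hom where hom: "pre_digraph.digraph_isomorphism (with_proj G) hom"
    and H: "with_proj H = app_iso hom (with_proj G)"
    unfolding digraph_iso_def by (elim exE conjE)
  let ?f = "iso_verts hom"
  have verts_H: "pverts H = ?f ` pverts G"
    using arg_cong[OF H, of verts] by simp
  have arcs_H: "parcs H = iso_arcs hom ` parcs G"
    using arg_cong[OF H, of arcs] by simp
  have tail_H: "iso_tail hom = fst"
    using arg_cong[OF H, of tail] by simp
  have head_H: "iso_head hom = snd"
    using arg_cong[OF H, of head] by simp
  have inj: "inj_on ?f (pverts G)"
    and arcs: "\<And>a. a \<in> parcs G \<Longrightarrow>
      ?f (fst a) = fst (iso_arcs hom a) \<and> ?f (snd a) = snd (iso_arcs hom a)"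
    using hom by (simp_all add: pre_digraph.digraph_isomorphism_def tail_H head_H)
  have "iso_arcs hom a = map_prod ?f ?f a" if "a \<in> parcs G" for a
    using arcs[OF that] by (simp add: prod_eq_iff)
  then have "parcs H = map_prod ?f ?f ` parcs G"
    unfolding arcs_H by (intro image_cong) auto
  then show "\<exists>f. bij_betw f (pverts G) (pverts H) \<and> parcs H = map_prod f f ` parcs G"
    using inj verts_H by (auto simp: bij_betw_def)
next
  assume "\<exists>f. bij_betw f (pverts G) (pverts H) \<and> parcs H = map_prod f f ` parcs G"
  then obtain f where f: "inj_on f (pverts G)" "f ` pverts G = pverts H"
    and arcs: "parcs H = map_prod f f ` parcs G"
    by (auto simp: bij_betw_def)
  interpret pair_wf_digraph G by fact
  let ?hom = "\<lparr>iso_verts = f, iso_arcs = map_prod f f, iso_head = snd, iso_tail = fst\<rparr>"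
  have "parcs G \<subseteq> pverts G \<times> pverts G"
    using wellformed' by auto
  then have "inj_on (map_prod f f) (parcs G)"
    by (rule inj_on_subset[OF map_prod_inj_on[OF f(1) f(1)]])
  then have "digraph_isomorphism ?hom"
    using f wf_digraph_axioms by (simp add: digraph_isomorphism_def)
  moreover have "with_proj H = app_iso ?hom (with_proj G)"
    using f arcs by (simp add: with_proj_def app_iso_def)
  ultimately show "digraph_iso (with_proj G) (with_proj H)"
    unfolding digraph_iso_def by blast
qed

lemma greedy_labelling_comp_iso:
  assumes "pair_wf_digraph G" "bij_betw f (pverts G) (pverts H)"
    "parcs H = map_prod f f ` parcs G" "greedy_labelling H c k"
  shows "greedy_labelling G (c \<circ> f) k"
proof -
  interpret pair_wf_digraph G by fact
  have inj: "inj_on f (pverts G)" and surj: "f ` pverts G = pverts H"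
    using assms(2) by (auto simp: bij_betw_def)
  have img: "c ` pverts H = {..<k}"
    and proper: "\<And>u v. (u, v) \<in> parcs H \<Longrightarrow> c u \<noteq> c v"
    and greedy: "\<And>v j. v \<in> pverts H \<Longrightarrow> j < c v \<Longrightarrow> \<exists>u\<in>pverts H. (v, u) \<in> parcs H \<and> c u = j"
    using assms(4) by (auto simp: greedy_labelling_def)
  have arc: "(u, v) \<in> parcs G"
    if uv: "(f u, f v) \<in> parcs H" "u \<in> pverts G" "v \<in> pverts G" for u v
  proof -
    obtain a b where ab: "(a, b) \<in> parcs G" "f u = f a" "f v = f b"
      using uv(1) unfolding assms(3) by auto
    then have "u = a" "v = b"
      using inj_onD[OF inj] uv(2,3) wellformed'[OF ab(1)] by blast+
    then show ?thesis
      using ab(1) by simp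
  qed
  show ?thesis
    unfolding greedy_labelling_def
  proof (intro conjI ballI allI impI)
    show "(c \<circ> f) ` pverts G = {..<k}"
      unfolding image_comp[symmetric] surj by (rule img)
  next
    fix u v assume "(u, v) \<in> parcs G"
    then have "(f u, f v) \<in> parcs H"
      using imageI[of "(u, v)" "parcs G" "map_prod f f"] by (simp add: assms(3))
    then show "(c \<circ> f) u \<noteq> (c \<circ> f) v"
      using proper by simp
  next
    fix v j assume v: "v \<in> pverts G" and "j < (c \<circ> f) v"
    then have "f v \<in> pverts H" "j < c (f v)"
      using surj by auto
    then obtain w where w: "w \<in> pverts H" "(f v, w) \<in> parcs H" "c w = j"
      using greedy by blast
    then obtain u where "u \<in> pverts G" "w = f u"
      using surj by blast
    then show "\<exists>u\<in>pverts G. (v, u) \<in> parcs G \<and> (c \<circ> f) u = j"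
      using arc[of v u] v w by (intro bexI[of _ u]) auto
  qed
qed

lemma parcs_B_graph_iff:
  "((s, i), (t, j)) \<in> parcs (B_graph k) \<longleftrightarrow>
     s \<noteq> t \<and> i < k - 1 \<and> j < k - 1 \<and> (i = j \<longrightarrow> k - 2 \<le> i)"
  by (auto simp: B_graph_def)

lemma pverts_B_graph: "pverts (B_graph k) = UNIV \<times> {..<k - 1}"
  by (simp add: B_graph_def)

text \<open>
  The ends of each deleted matching edge share a color, and the two ends of the remaining
  edge at index \<open>k - 2\<close> get the two highest colors. A vertex finds its neighbour of a lower color
  \<open>j\<close> at index \<open>j\<close> on the opposite side.
\<close>

lemma greedy_labelling_B_graph:
  assumes "2 \<le> k"
  shows "greedy_labelling (B_graph k) (\<lambda>(s, i). if s \<and> i = k - 2 then k - 1 else i) k"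
    (is "greedy_labelling ?B ?c k")
  unfolding greedy_labelling_def
proof (intro conjI ballI allI impI)
  show "?c ` pverts ?B = {..<k}"
  proof
    show "?c ` pverts ?B \<subseteq> {..<k}"
      using assms by (auto simp: pverts_B_graph)
    show "{..<k} \<subseteq> ?c ` pverts ?B"
    proof
      fix j assume "j \<in> {..<k}"
      then show "j \<in> ?c ` pverts ?B"
        using assms
        by (intro image_eqI[of _ _ "if j = k - 1 then (True, k - 2) else (False, j)"])
          (auto simp: pverts_B_graph)
    qed
  qed
next
  fix u v assume "(u, v) \<in> parcs ?B"
  then show "?c u \<noteq> ?c v"
    by (cases u; cases v) (auto simp: parcs_B_graph_iff)
next
  fix v j assume v: "v \<in> pverts ?B" and j: "j < ?c v"
  obtain s i where si: "v = (s, i)"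
    by (cases v)
  have "(v, (\<not> s, j)) \<in> parcs ?B" "(\<not> s, j) \<in> pverts ?B" "?c (\<not> s, j) = j"
    using v j assms unfolding si
    by (auto simp: parcs_B_graph_iff pverts_B_graph split: if_splits)
  then show "\<exists>u\<in>pverts ?B. (v, u) \<in> parcs ?B \<and> ?c u = j"
    by blast
qed

lemma grundy_number_iso_B_graph:
  assumes "pair_graph G" "triangle_free G" "2 \<le> k" "card (pverts G) = 2 * k - 2"
    "digraph_iso (with_proj G) (with_proj (B_graph k))"
  shows "grundy_number G = k"
proof (rule antisym)
  interpret pair_graph G by fact
  show "grundy_number G \<le> k"
    using grundy_number_upper_bound[OF assms(1)] assms(3,4)
      clique_number_triangle_free[OF pair_finite_verts assms(2)] by linarith
  obtain f where "bij_betw f (pverts G) (pverts (B_graph k))"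
    "parcs (B_graph k) = map_prod f f ` parcs G"
    using iffD1[OF digraph_iso_with_proj_iff[OF pair_wf_digraph_axioms] assms(5)]
    by (elim exE conjE)
  then have "greedy_labelling G ((\<lambda>(s, i). if s \<and> i = k - 2 then k - 1 else i) \<circ> f) k"
    by (rule greedy_labelling_comp_iso[OF pair_wf_digraph_axioms _ _ greedy_labelling_B_graph[OF assms(3)]])
  then show "k \<le> grundy_number G"
    by (rule le_grundy_number[OF assms(1) grundy_coloring_greedy_labelling])
qed

text \<open>
  A triangle-free graph has clique number at most 2, so the assumed number of vertices turns the
  inequalities behind \<open>grundy_coloring_bound\<close> into equalities.
\<close>

lemma extremal_class_sizes:
  assumes "pair_graph G" "triangle_free G" "grundy_coloring G k V"
    "card (pverts G) + 2 = 2 * k"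
  shows "card {i \<in> {1..k}. card (V i) = 1} = 2"
    and "\<And>i. i \<in> {1..k} \<Longrightarrow> card (V i) \<noteq> 1 \<Longrightarrow> card (V i) = 2"
proof -
  interpret pair_graph G by fact
  let ?S = "{i \<in> {1..k}. card (V i) = 1}"
  let ?f = "\<lambda>i. 2 - of_bool (card (V i) = 1) :: nat"
  have le: "?f i \<le> card (V i)" if "i \<in> {1..k}" for i
    using grundy_class_card_ge[OF pair_finite_verts assms(3) that] .
  have "sum ?f {1..k} \<le> (\<Sum>i\<in>{1..k}. card (V i))"
    by (rule sum_mono[OF le])
  moreover have "card ?S \<le> 2"
    using card_singleton_classes_le_clique_number[OF assms(1,3)]
      clique_number_triangle_free[OF pair_finite_verts assms(2)] by linarith
  moreover note sum_two_minus_of_bool[of "{1..k}" "\<lambda>i. card (V i) = 1"]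
    sum_card_grundy_classes[OF pair_finite_verts assms(3)] assms(4)
  ultimately have "card ?S = 2" and eq: "sum ?f {1..k} = (\<Sum>i\<in>{1..k}. card (V i))"
    by simp_all
  then show "card ?S = 2"
    by simp
  show "card (V i) = 2" if "i \<in> {1..k}" "card (V i) \<noteq> 1" for i
    using sum_mono_inv[OF eq le that(1)] that by simp
qed

text \<open>
  A vertex in a class above \<open>q\<close> would be adjacent to both \<open>x\<close> and \<open>y\<close>; a class strictly between
  \<open>p\<close> and \<open>q\<close> would contain a neighbour of \<open>y\<close>, which is adjacent to \<open>x\<close> as well. Either way the
  edge between \<open>x\<close> and \<open>y\<close> completes a triangle.
\<close>

lemma singleton_classes_on_top:
  assumes "pair_graph G" "triangle_free G" "grundy_coloring G k V"
    "1 \<le> p" "p < q" "q \<le> k" "V p = {x}" "V q = {y}"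
  shows "q = k" "p = k - 1"
proof -
  note tri = triangle_free_neighbours[OF assms(1,2)]
  note nb = grundy_class_neighbour[OF assms(3)]
  have to_x: "(v, x) \<in> parcs G" if "i \<in> {1..k}" "p < i" "v \<in> V i" for i v
    using nb[of i v p] that assms(4,7) by simp
  have to_y: "(v, y) \<in> parcs G" if "i \<in> {1..k}" "q < i" "v \<in> V i" for i v
    using nb[of i v q] that assms(4,5,8) by simp
  have yx: "(y, x) \<in> parcs G"
    using to_x[of q y] assms(4-6,8) by simp
  then have xy: "(x, y) \<in> parcs G"
    using pair_graph_arc_commute[OF assms(1)] by simp
  show q: "q = k"
  proof (rule ccontr)
    assume "q \<noteq> k"
    then have k: "k \<in> {1..k}" "q < k" "p < k"
      using assms(4-6) by simp_all
    obtain v where v: "v \<in> V k"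
      using grundy_class_nonempty[OF assms(3) k(1)] by blast
    show False
      using tri[OF to_x[OF k(1,3) v] to_y[OF k(1,2) v]] xy by simp
  qed
  show "p = k - 1"
  proof (rule ccontr)
    assume "p \<noteq> k - 1"
    then have i: "k - 1 \<in> {1..k}" "p < k - 1" "1 \<le> k - 1" "k - 1 < q"
      using assms(4-6) q by auto
    then obtain v where v: "v \<in> V (k - 1)" "(y, v) \<in> parcs G"
      using nb[of q y "k - 1"] assms(4-6,8) by auto
    show False
      using tri[OF v(2) yx] to_x[OF i(1,2) v(1)] by simp
  qed
qed

text \<open>
  The coloring determines the graph. Below the two singletons \<open>x\<close> and \<open>y\<close>, each class splits into a
  neighbour \<open>a j\<close> of \<open>x\<close> and a neighbour \<open>b j\<close> of \<open>y\<close>. Triangle-freeness forbids the adjacencies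
  within \<open>{a j} \<union> {y}\<close> and within \<open>{b j} \<union> {x}\<close>, and the Grundy condition then enforces all the
  others except those inside a class.
\<close>

lemma extremal_triangle_free_iso_B_graph:
  assumes "pair_graph G" "triangle_free G" "grundy_coloring G k V"
    "card (pverts G) + 2 = 2 * k"
  shows "digraph_iso (with_proj G) (with_proj (B_graph k))"
proof -
  interpret pair_graph G by fact
  note tri = triangle_free_neighbours[OF assms(1,2)]
  note commute = pair_graph_arc_commute[OF assms(1)]
  note nb = grundy_class_neighbour[OF assms(3)]
  define S where "S = {i \<in> {1..k}. card (V i) = 1}"
  have "card S = 2"
    unfolding S_def by (rule extremal_class_sizes(1)[OF assms])
  then obtain p q where S: "S = {p, q}" and less: "p < q"
    by (metis card_2_iff insert_commute linorder_neqE_nat)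
  then have "p \<in> S" "q \<in> S"
    by simp_all
  then have pq: "1 \<le> p" "q \<le> k" "card (V p) = 1" "card (V q) = 1"
    by (simp_all add: S_def)
  obtain x where "V p = {x}"
    using pq(3) by (rule card_1_singletonE)
  moreover obtain y where "V q = {y}"
    using pq(4) by (rule card_1_singletonE)
  ultimately have V_pq: "V p = {x}" "V q = {y}" .
  have q: "q = k" and p: "p = k - 1"
    by (rule singleton_classes_on_top[OF assms(1-3) pq(1) less pq(2) V_pq])+
  have x: "V (k - 1) = {x}" and y: "V k = {y}" and k: "2 \<le> k"
    using V_pq p q pq(1) less by simp_all
  have yx: "(y, x) \<in> parcs G"
    using nb[of k y "k - 1"] x y k by auto
  then have xy: "(x, y) \<in> parcs G"
    using commute by simp
  have "\<exists>a b. V j = {a, b} \<and> (x, a) \<in> parcs G \<and> (y, b) \<in> parcs G"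
    if j: "1 \<le> j" "j \<le> k - 2" for j
  proof -
    have i: "k - 1 \<in> {1..k}" "j < k - 1" "k \<in> {1..k}" "j < k" "j \<in> {1..k}" "j \<noteq> p" "j \<noteq> q"
      using j k p q by auto
    obtain a where a: "a \<in> V j" "(x, a) \<in> parcs G"
      using nb[OF i(1) _ j(1) i(2)] x by blast
    obtain b where b: "b \<in> V j" "(y, b) \<in> parcs G"
      using nb[OF i(3) _ j(1) i(4)] y by blast
    have "(a, y) \<notin> parcs G"
      by (rule tri[OF a(2) xy])
    then have "a \<noteq> b"
      using b(2) commute by auto
    moreover have "j \<notin> S"
      using S i by simp
    then have "card (V j) = 2"
      using extremal_class_sizes(2)[OF assms i(5)] i(5) by (simp add: S_def)
    ultimately have "V j = {a, b}"
      using a b by (auto simp: card_2_iff)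
    then show ?thesis
      using a b by blast
  qed
  then obtain a b where ab: "\<And>j. 1 \<le> j \<Longrightarrow> j \<le> k - 2 \<Longrightarrow> V j = {a j, b j}"
    and xa: "\<And>j. 1 \<le> j \<Longrightarrow> j \<le> k - 2 \<Longrightarrow> (x, a j) \<in> parcs G"
    and yb: "\<And>j. 1 \<le> j \<Longrightarrow> j \<le> k - 2 \<Longrightarrow> (y, b j) \<in> parcs G"
    by metis
  have aa: "(a i, a j) \<notin> parcs G" if "1 \<le> i" "i \<le> k - 2" "1 \<le> j" "j \<le> k - 2" for i j
    by (rule tri[OF xa[OF that(1,2)] xa[OF that(3,4)]])
  have bb: "(b i, b j) \<notin> parcs G" if "1 \<le> i" "i \<le> k - 2" "1 \<le> j" "j \<le> k - 2" for i j
    by (rule tri[OF yb[OF that(1,2)] yb[OF that(3,4)]])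
  have xb: "(x, b j) \<notin> parcs G" if "1 \<le> j" "j \<le> k - 2" for j
    by (rule tri[OF yx yb[OF that]])
  have ya: "(y, a j) \<notin> parcs G" if "1 \<le> j" "j \<le> k - 2" for j
    by (rule tri[OF xy xa[OF that]])
  \<comment> \<open>The neighbour demanded in class \<open>j\<close> cannot be the member of the same kind.\<close>
  have below: "(a i, b j) \<in> parcs G" "(b i, a j) \<in> parcs G"
    if "1 \<le> j" "j < i" "i \<le> k - 2" for i j
  proof -
    have V: "V i = {a i, b i}" "V j = {a j, b j}" and i: "i \<in> {1..k}"
      using ab that by auto
    show "(a i, b j) \<in> parcs G"
      using nb[of i "a i" j] V i that aa[of i j] by auto
    show "(b i, a j) \<in> parcs G"
      using nb[of i "b i" j] V i that bb[of i j] by auto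
  qed
  have neq: "(a i, b j) \<in> parcs G \<longleftrightarrow> i \<noteq> j"
    if "1 \<le> i" "i \<le> k - 2" "1 \<le> j" "j \<le> k - 2" for i j
  proof (cases i j rule: linorder_cases)
    case equal
    then show ?thesis
      using grundy_class_independent[OF assms(3), of i "a i" "b i"] ab[of i] that by auto
  next
    case less
    then show ?thesis
      using below(2)[of i j] that commute[of "a i"] by simp
  next
    case greater
    then show ?thesis
      using below(1)[of j i] that by simp
  qed
  note loop = pair_graph_loopless[OF assms(1)]
  \<comment> \<open>The two sides of \<open>B\<^sub>k\<close>; indices start at 0 there, and the last one, \<open>k - 2\<close>, is the unmatched pair \<open>y, x\<close>.\<close>
  define a' where "a' i = (if i = k - 2 then y else a (Suc i))" for i
  define b' where "b' i = (if i = k - 2 then x else b (Suc i))" for i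
  have Suc_le: "Suc i \<le> k - 2" if "i < k - 1" "i \<noteq> k - 2" for i
    using that by simp
  have a'a': "(a' i, a' j) \<notin> parcs G" if ij: "i < k - 1" "j < k - 1" for i j
    using loop[of y] aa[of "Suc i" "Suc j"] ya[of "Suc i"] ya[of "Suc j"]
      commute[of "a (Suc i)" y] Suc_le[OF ij(1)] Suc_le[OF ij(2)]
    by (cases "i = k - 2"; cases "j = k - 2") (simp_all add: a'_def)
  have b'b': "(b' i, b' j) \<notin> parcs G" if ij: "i < k - 1" "j < k - 1" for i j
    using loop[of x] bb[of "Suc i" "Suc j"] xb[of "Suc i"] xb[of "Suc j"]
      commute[of "b (Suc i)" x] Suc_le[OF ij(1)] Suc_le[OF ij(2)]
    by (cases "i = k - 2"; cases "j = k - 2") (simp_all add: b'_def)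
  have a'b': "(a' i, b' j) \<in> parcs G \<longleftrightarrow> (i = j \<longrightarrow> k - 2 \<le> i)"
    if ij: "i < k - 1" "j < k - 1" for i j
    using yx neq[of "Suc i" "Suc j"] xa[of "Suc i"] yb[of "Suc j"]
      commute[of "a (Suc i)" x] Suc_le[OF ij(1)] Suc_le[OF ij(2)]
    by (cases "i = k - 2"; cases "j = k - 2") (auto simp: a'_def b'_def)
  define h where "h = (\<lambda>(s, i). if s then b' i else a' i)"
  have arc: "(h u, h v) \<in> parcs G \<longleftrightarrow> (u, v) \<in> parcs (B_graph k)"
    if "u \<in> pverts (B_graph k)" "v \<in> pverts (B_graph k)" for u v
  proof -
    obtain s i t j where uv: "u = (s, i)" "v = (t, j)"
      by (cases u, cases v)
    have ij: "i < k - 1" "j < k - 1"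
      using that uv by (simp_all add: pverts_B_graph)
    have "(b' i, a' j) \<in> parcs G \<longleftrightarrow> (i = j \<longrightarrow> k - 2 \<le> i)"
      using a'b'[OF ij(2,1)] commute[of "b' i" "a' j"] by auto
    then show ?thesis
      unfolding uv parcs_B_graph_iff h_def using ij a'a'[OF ij] b'b'[OF ij] a'b'[OF ij]
      by (cases s; cases t) simp_all
  qed
  have img: "h ` pverts (B_graph k) = pverts G"
  proof
    have V_sub: "V i \<subseteq> pverts G" if "i \<in> {1..k}" for i
      using grundy_class_subset[OF assms(3) that] .
    show "h ` pverts (B_graph k) \<subseteq> pverts G"
    proof (rule image_subsetI)
      fix u assume "u \<in> pverts (B_graph k)"
      then obtain s i where u: "u = (s, i)" "i < k - 1"
        by (auto simp: pverts_B_graph)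
      show "h u \<in> pverts G"
      proof (cases "i = k - 2")
        case True
        then show ?thesis
          using V_sub[of k] V_sub[of "k - 1"] x y k u by (auto simp: h_def a'_def b'_def)
      next
        case False
        then show ?thesis
          using V_sub[of "Suc i"] ab[of "Suc i"] u by (auto simp: h_def a'_def b'_def)
      qed
    qed
    show "pverts G \<subseteq> h ` pverts (B_graph k)"
    proof
      fix v assume "v \<in> pverts G"
      then obtain j where j: "j \<in> {1..k}" "v \<in> V j"
        using grundy_classes_cover[OF assms(3)] by blast
      \<comment> \<open>In a class \<open>{a j, b j}\<close> the side is decided by testing whether \<open>v\<close> is \<open>b j\<close>.\<close>
      let ?u = "if j = k then (False, k - 2) else if j = k - 1 then (True, k - 2)
        else (v = b j, j - 1)"
      have h: "h ?u = v" and u: "?u \<in> pverts (B_graph k)"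
        using j x y k ab[of j]
        by (auto simp: h_def a'_def b'_def pverts_B_graph split: if_splits)
      show "v \<in> h ` pverts (B_graph k)"
        using imageI[OF u, of h] unfolding h .
    qed
  qed
  have "card (pverts (B_graph k)) = card (pverts G)"
    using assms(4) by (simp add: pverts_B_graph)
  then have inj: "inj_on h (pverts (B_graph k))"
    using img by (intro eq_card_imp_inj_on) (auto simp: pverts_B_graph)
  define f where "f = inv_into (pverts (B_graph k)) h"
  have hf: "h (f v) = v" "f v \<in> pverts (B_graph k)" if "v \<in> pverts G" for v
    using that img by (auto simp: f_def f_inv_into_f inv_into_into)
  have fh: "f (h u) = u" if "u \<in> pverts (B_graph k)" for u
    using that inj by (simp add: f_def)
  have "bij_betw f (pverts G) (pverts (B_graph k))"
    unfolding f_def using inj img by (intro bij_betw_inv_into) (simp add: bij_betw_def)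
  moreover have "parcs (B_graph k) = map_prod f f ` parcs G"
  proof
    show "parcs (B_graph k) \<subseteq> map_prod f f ` parcs G"
    proof
      fix e assume e: "e \<in> parcs (B_graph k)"
      obtain u v where uv: "e = (u, v)" "u \<in> pverts (B_graph k)" "v \<in> pverts (B_graph k)"
        using e by (cases e) (auto simp: parcs_B_graph_iff pverts_B_graph)
      then show "e \<in> map_prod f f ` parcs G"
        using e arc[of u v] fh by (intro image_eqI[of _ _ "(h u, h v)"]) auto
    qed
    show "map_prod f f ` parcs G \<subseteq> parcs (B_graph k)"
    proof (rule image_subsetI)
      fix e assume e: "e \<in> parcs G"
      obtain u v where uv: "e = (u, v)"
        by (cases e)
      then have "u \<in> pverts G" "v \<in> pverts G"
        using wellformed'[of u v] e by simp_all
      then show "map_prod f f e \<in> parcs (B_graph k)"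
        using arc[of "f u" "f v"] hf e uv by simp
    qed
  qed
  ultimately show ?thesis
    by (intro iffD2[OF digraph_iso_with_proj_iff[OF pair_wf_digraph_axioms]] exI conjI)
qed

theorem theorem2p6:
  shows
    "(\<forall>G :: 'a pair_pre_digraph. pair_graph G \<and> card (pverts G) \<ge> 1 \<longrightarrow>
        real (grundy_number G) \<le> (real (card (pverts G)) + real (clique_number G)) / 2)
     \<and>
     (\<forall>k n :: nat. even (k + n) \<and> k \<le> n \<and> (2 \<le> k \<or> k = n) \<longrightarrow>
        (\<exists>G :: nat pair_pre_digraph. pair_graph G \<and> card (pverts G) = n \<and>
           clique_number G = k \<and> real (grundy_number G) = (real n + real k) / 2))
     \<and>
     (\<forall>(G :: 'a pair_pre_digraph) n. pair_graph G \<and> Digraph_Component.connected (with_proj G) \<and>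
        triangle_free G \<and> card (pverts G) = n \<and> n \<ge> 2 \<longrightarrow>
        (real (grundy_number G) = (real n + 2) / 2 \<longleftrightarrow>
         (\<exists>k. real k = (real n + 2) / 2 \<and> digraph_iso (with_proj G) (with_proj (B_graph k)))))"
proof (intro conjI allI impI)
  fix G :: "'a pair_pre_digraph"
  assume "pair_graph G \<and> card (pverts G) \<ge> 1"
  then have "2 * grundy_number G \<le> card (pverts G) + clique_number G"
    using grundy_number_upper_bound by blast
  then have "real (2 * grundy_number G) \<le> real (card (pverts G) + clique_number G)"
    by (simp only: of_nat_le_iff)
  then show "real (grundy_number G) \<le> (real (card (pverts G)) + real (clique_number G)) / 2"
    by simp
next
  fix k n :: nat
  assume kn: "even (k + n) \<and> k \<le> n \<and> (2 \<le> k \<or> k = n)"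
  define m where "m = (n - k) div 2"
  have n: "n = 2 * m + k" and k: "2 \<le> k \<or> m = 0"
    using kn by (auto simp: m_def)
  show "\<exists>G :: nat pair_pre_digraph. pair_graph G \<and> card (pverts G) = n \<and>
      clique_number G = k \<and> real (grundy_number G) = (real n + real k) / 2"
  proof (intro exI conjI)
    show "pair_graph (extremal_graph k m)"
      by (rule pair_graph_extremal)
    show "card (pverts (extremal_graph k m)) = n"
      by (simp add: n extremal_graph_def)
    show "clique_number (extremal_graph k m) = k"
      by (rule clique_number_extremal[OF k])
    show "real (grundy_number (extremal_graph k m)) = (real n + real k) / 2"
      by (simp add: n grundy_number_extremal[OF k])
  qed
next
  fix G :: "'a pair_pre_digraph" and n
  assume G: "pair_graph G \<and> Digraph_Component.connected (with_proj G) \<and>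
    triangle_free G \<and> card (pverts G) = n \<and> n \<ge> 2"
  then have graph: "pair_graph G" and tri: "triangle_free G" and n: "card (pverts G) = n" "2 \<le> n"
    by simp_all
  show "real (grundy_number G) = (real n + 2) / 2 \<longleftrightarrow>
    (\<exists>k. real k = (real n + 2) / 2 \<and> digraph_iso (with_proj G) (with_proj (B_graph k)))"
  proof
    assume eq: "real (grundy_number G) = (real n + 2) / 2"
    obtain V where V: "grundy_coloring G (grundy_number G) V"
      by (rule grundy_number_attained[OF graph])
    have "real (card (pverts G) + 2) = real (2 * grundy_number G)"
      using eq n by simp
    then have "card (pverts G) + 2 = 2 * grundy_number G"
      by (simp only: of_nat_eq_iff)
    then have "digraph_iso (with_proj G) (with_proj (B_graph (grundy_number G)))"
      by (rule extremal_triangle_free_iso_B_graph[OF graph tri V])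
    with eq show "\<exists>k. real k = (real n + 2) / 2 \<and>
        digraph_iso (with_proj G) (with_proj (B_graph k))"
      by (intro exI conjI)
  next
    assume "\<exists>k. real k = (real n + 2) / 2 \<and> digraph_iso (with_proj G) (with_proj (B_graph k))"
    then obtain k where k: "real k = (real n + 2) / 2"
      and iso: "digraph_iso (with_proj G) (with_proj (B_graph k))"
      by (elim exE conjE)
    have "real (2 * k) = real (n + 2)"
      using k by simp
    then have "2 * k = n + 2"
      by (simp only: of_nat_eq_iff)
    then have "2 \<le> k" "card (pverts G) = 2 * k - 2"
      using n by linarith+
    then have "grundy_number G = k"
      by (rule grundy_number_iso_B_graph[OF graph tri _ _ iso])
    then show "real (grundy_number G) = (real n + 2) / 2"
      using k by simp
  qed
qed

end
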